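(* Let $(\mathcal{Q},\vartheta)$ be a minimal $\sigma$-periodic flow and let $\psi$ be a cocycle in a Banach space $\mathbb{E}$ (over $\mathbb{R}$ or $\mathbb{C}$) over $(\mathcal{Q},\vartheta)$. Suppose there are a constant symmetric operator $P\in\mathcal{L}(\mathbb{E};\mathbb{E}^* )$ and a constant direct sum decomposition $\mathbb{E}=\mathbb{E}^+\oplus\mathbb{E}^-$ with $\dim\mathbb{E}^-=1$ such that $V(v):=\langle v,Pv\rangle$ is positive on $\mathbb{E}^+\setminus\{0\}$ and negative on $\mathbb{E}^-\setminus\{0\}$, and that $\psi$ satisfies the squeezing property with respect to $V$ with continuous $\nu_0(\cdot)$ and $\nu^->0$, asymptotic compactness with exponent $\gamma^+=\nu^+$, and the uniform Lipschitz property. Then any trajectory $\mathbb{R}_+\ni t\mapsto\psi^t(q,v_0)$ ($q\in\mathcal{Q}$, $v_0\in\mathbb{E}$) which is bounded in the future converges to a $\sigma$-periodic trajectory, i.e. there is a $\sigma$-periodic complete trajectory $w^*(\cdot)$ over $q$ with $\|\psi^t(q,v_0)-w^*(t)\|_{\mathbb{E}}\to0$ as $t\to+\infty$.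
   Context: $\mathbb{R}_+=[0,\infty)$, $\sigma>0$. A minimal $\sigma$-periodic flow $(\mathcal{Q},\vartheta)$ is a (jointly continuous) flow on a complete metric space $\mathcal{Q}$ consisting of a single $\sigma$-periodic orbit: $\vartheta^\sigma=\mathrm{id}$ and $\mathcal{Q}=\{\vartheta^t(q):t\in[0,\sigma]\}$ for each $q$. $\mathbb{E}$ is continuously embedded in a Hilbert space $\mathbb{H}$ with norm $|\cdot|_{\mathbb{H}}$. A cocycle $\psi$ in $\mathbb{E}$ over $(\mathcal{Q},\vartheta)$ is a family of maps $\psi^t(q,\cdot)\colon\mathbb{E}\to\mathbb{E}$, $t\ge0$, $q\in\mathcal{Q}$, with $\psi^0(q,v)=v$, $\psi^{t+s}(q,v)=\psi^t(\vartheta^s(q),\psi^s(q,v))$ and $(t,q,v)\mapsto\psi^t(q,v)$ continuous. $\langle v,f\rangle$ is the pairing of $v\in\mathbb{E}$, $f\in\mathbb{E}^*$ (in the complex case $\mathbb{E}^*$ consists of conjugate-linear functionals); $P$ is symmetric if $\langle v_1,Pv_2\rangle=\overline{\langle v_2,Pv_1\rangle}$ for all $v_1,v_2\in\mathbb{E}$. A complete trajectory over $q$ is a continuous $v\colon\mathbb{R}\to\mathbb{E}$ with $v(t+s)=\psi^t(\vartheta^s(q),v(s))$ for $t\ge0$, $s\in\mathbb{R}$. Squeezing property: there are constants $\nu^-<\nu^+$, $\delta_P>0$, $\tau_P\ge0$ and a Borel function $\nu_0\colon\mathcal{Q}\to\mathbb{R}_+$ with $\nu^-\le\nu_0(\cdot)\le\nu^+$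 such that with $\nu(t;q)=\int_0^t\nu_0(\vartheta^s(q))ds$ $$e^{2\nu(r;q)}V(\psi^r(q,v_1)-\psi^r(q,v_2))-e^{2\nu(l;q)}V(\psi^l(q,v_1)-\psi^l(q,v_2))\le-\delta_P\int_l^re^{2\nu(s;q)}|\psi^s(q,v_1)-\psi^s(q,v_2)|^2_{\mathbb{H}}ds$$ for all $q\in\mathcal{Q}$, $v_1,v_2\in\mathbb{E}$ and $r,l\ge0$ with $r-l\ge\tau_P$. Uniform Lipschitz property: there is $\tau_S\ge0$ such that for every $T>0$ there is $L_T>0$ with $\|\psi^t(q,v_1)-\psi^t(q,v_2)\|_{\mathbb{E}}\le L_T|v_1-v_2|_{\mathbb{H}}$ for $t\in[\tau_S,\tau_S+T]$ and $\|\psi^t(q,v_1)-\psi^t(q,v_2)\|_{\mathbb{E}}\le L_T\|v_1-v_2\|_{\mathbb{E}}$ for $t\in[0,T]$, for all $q,v_1,v_2$. Asymptotic compactness with exponent $\gamma^+$: for every compact $\mathcal{C}\subset\mathcal{Q}$ there is $\gamma_0\colon\mathbb{R}_+\to\mathbb{R}_+$ with $\gamma_0(t)\to0$ as $t\to+\infty$ and $\alpha_K(\psi^t(\mathcal{C},\mathcal{B}))\le\gamma_0(t)e^{-\gamma^+t}\alpha_K(\mathcal{B})$ for all $t\ge0$ and bounded $\mathcal{B}\subset\mathbb{E}$, where $\alpha_K$ is the Kuratowski measure of noncompactness in $\mathbb{E}$.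
   Formalization: The dimension of E^- is taken over R, so the claim has content only for real E; over C with complex dimension one it fails: E=H=C, V(v)=-|v|^2, psi^t(q,v)=e^{it}v, sigma=1 meets all hypotheses, but its bounded trajectories do not converge to 1-periodic ones. *)

theory Defs
  imports "HOL-Analysis.Analysis"
begin

(* The scalar fields R and C. The axioms make to_complex an isometric R-algebra isomorphism of
   the type onto the real line in C or onto C, and rc_cnj complex conjugation. *)
class real_or_complex = real_normed_field +
  fixes to_complex :: "'a \<Rightarrow> complex"
    and rc_cnj :: "'a \<Rightarrow> 'a"
  assumes to_complex_add: "to_complex (a + b) = to_complex a + to_complex b"
    and to_complex_mult: "to_complex (a * b) = to_complex a * to_complex b"
    and to_complex_scaleR_one: "to_complex (r *\<^sub>R 1) = complex_of_real r"
    and norm_to_complex: "norm (to_complex a) = norm a"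
    and to_complex_cnj: "to_complex (rc_cnj a) = cnj (to_complex a)"
    and range_to_complex: "range to_complex = \<real> \<or> range to_complex = UNIV"

instantiation real :: real_or_complex
begin

definition "to_complex = complex_of_real"
definition "rc_cnj = (\<lambda>x::real. x)"

instance
  by standard (auto simp: to_complex_real_def rc_cnj_real_def Reals_def)

end

instantiation complex :: real_or_complex
begin

definition "to_complex = (\<lambda>z::complex. z)"
definition "rc_cnj = cnj"

instance
  by standard (auto simp: to_complex_complex_def rc_cnj_complex_def scaleR_conv_of_real)

end

locale banach_over = vector_space smul
  for smul :: "'k::real_or_complex \<Rightarrow> 'e::banach \<Rightarrow> 'e" +
  assumes smul_of_real: "smul (of_real r) v = r *\<^sub>R v"
    and norm_smul: "norm (smul c v) = norm c * norm v"

locale hilbert_over = banach_over smul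
  for smul :: "'k::real_or_complex \<Rightarrow> 'h::banach \<Rightarrow> 'h" +
  fixes ip :: "'h \<Rightarrow> 'h \<Rightarrow> 'k"
  assumes ip_add: "ip (u + v) w = ip u w + ip v w"
    and ip_smul: "ip (smul c v) w = c * ip v w"
    and ip_cnj: "ip v w = rc_cnj (ip w v)"
    and ip_norm: "ip v v = of_real ((norm v)\<^sup>2)"

definition continuous_embedding ::
  "('k::real_or_complex \<Rightarrow> 'e::banach \<Rightarrow> 'e) \<Rightarrow> ('k \<Rightarrow> 'h::banach \<Rightarrow> 'h) \<Rightarrow> ('e \<Rightarrow> 'h) \<Rightarrow> bool"
  where "continuous_embedding smulE smulH \<iota> \<longleftrightarrow>
    Vector_Spaces.linear smulE smulH \<iota> \<and> inj \<iota> \<and> continuous_on UNIV \<iota>"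

definition flow :: "(real \<Rightarrow> 'q::metric_space \<Rightarrow> 'q) \<Rightarrow> bool"
  where "flow \<theta> \<longleftrightarrow>
    \<theta> 0 = id \<and> (\<forall>t s. \<theta> (t + s) = \<theta> t \<circ> \<theta> s) \<and> continuous_on UNIV (\<lambda>(t, q). \<theta> t q)"

definition minimal_periodic_flow :: "real \<Rightarrow> (real \<Rightarrow> 'q::complete_space \<Rightarrow> 'q) \<Rightarrow> bool"
  where "minimal_periodic_flow \<sigma> \<theta> \<longleftrightarrow>
    \<sigma> > 0 \<and> flow \<theta> \<and> \<theta> \<sigma> = id \<and> (\<forall>q. UNIV = (\<lambda>t. \<theta> t q) ` {0..\<sigma>})"

definition cocycle ::
  "(real \<Rightarrow> 'q::metric_space \<Rightarrow> 'q) \<Rightarrow> (real \<Rightarrow> 'q \<Rightarrow> 'e::banach \<Rightarrow> 'e) \<Rightarrow> bool"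
  where "cocycle \<theta> \<psi> \<longleftrightarrow>
    (\<forall>q v. \<psi> 0 q v = v) \<and>
    (\<forall>t\<ge>0. \<forall>s\<ge>0. \<forall>q v. \<psi> (t + s) q v = \<psi> t (\<theta> s q) (\<psi> s q v)) \<and>
    continuous_on ({0..} \<times> UNIV \<times> UNIV) (\<lambda>(t, q, v). \<psi> t q v)"

definition complete_trajectory ::
  "(real \<Rightarrow> 'q::metric_space \<Rightarrow> 'q) \<Rightarrow> (real \<Rightarrow> 'q \<Rightarrow> 'e::banach \<Rightarrow> 'e) \<Rightarrow> 'q \<Rightarrow> (real \<Rightarrow> 'e) \<Rightarrow> bool"
  where "complete_trajectory \<theta> \<psi> q w \<longleftrightarrow>
    continuous_on UNIV w \<and> (\<forall>t\<ge>0. \<forall>s. w (t + s) = \<psi> t (\<theta> s q) (w s))"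

(* The space L(E; E^* ) for the dual E^* of conjugate-linear functionals; the pairing of v with
   P w is P w v. The type only provides real linearity and boundedness. *)
definition operator_to_dual ::
  "('k::real_or_complex \<Rightarrow> 'e::banach \<Rightarrow> 'e) \<Rightarrow> ('e \<Rightarrow>\<^sub>L ('e \<Rightarrow>\<^sub>L 'k)) \<Rightarrow> bool"
  where "operator_to_dual smul P \<longleftrightarrow>
    (\<forall>w c v. P w (smul c v) = rc_cnj c * P w v) \<and>
    (\<forall>c w v. P (smul c w) v = c * P w v)"

definition symmetric_operator :: "('e::banach \<Rightarrow>\<^sub>L ('e \<Rightarrow>\<^sub>L 'k::real_or_complex)) \<Rightarrow> bool"
  where "symmetric_operator P \<longleftrightarrow> (\<forall>v1 v2. P v2 v1 = rc_cnj (P v1 v2))"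

(* For symmetric P the value P v v is real, so that Re only changes the type. *)
definition quadratic_form :: "('e::banach \<Rightarrow>\<^sub>L ('e \<Rightarrow>\<^sub>L 'k::real_or_complex)) \<Rightarrow> 'e \<Rightarrow> real"
  where "quadratic_form P v = Re (to_complex (P v v))"

(* The subspaces, and their dimensions, are taken over R also if the scalars are complex. With
   dimension 1 over C the convergence theorem fails: the rotation by exp(i t) of E = C with
   P v = - v satisfies all the other hypotheses. For complex scalars a form that is negative on a
   real line and positive on a real complement of it does not exist, since V(i v) = V(v). *)
definition direct_sum_decomposition :: "'e::real_vector set \<Rightarrow> 'e set \<Rightarrow> bool"
  where "direct_sum_decomposition Ep Em \<longleftrightarrow>
    subspace Ep \<and> subspace Em \<and> Ep \<inter> Em = {0} \<and> (\<forall>v. \<exists>a\<in>Ep. \<exists>b\<in>Em. v = a + b)"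

(* nu(t; q), used for t \<ge> 0 only *)
definition exponent_integral ::
  "(real \<Rightarrow> 'q::metric_space \<Rightarrow> 'q) \<Rightarrow> ('q \<Rightarrow> real) \<Rightarrow> real \<Rightarrow> 'q \<Rightarrow> real"
  where "exponent_integral \<theta> \<nu>0 t q = integral {0..t} (\<lambda>s. \<nu>0 (\<theta> s q))"

definition squeezing ::
  "(real \<Rightarrow> 'q::metric_space \<Rightarrow> 'q) \<Rightarrow> (real \<Rightarrow> 'q \<Rightarrow> 'e::banach \<Rightarrow> 'e) \<Rightarrow> ('e \<Rightarrow> 'h::banach) \<Rightarrow>
    ('e \<Rightarrow> real) \<Rightarrow> real \<Rightarrow> real \<Rightarrow> ('q \<Rightarrow> real) \<Rightarrow> bool"
  where "squeezing \<theta> \<psi> \<iota> V \<nu>m \<nu>p \<nu>0 \<longleftrightarrow>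
    \<nu>m < \<nu>p \<and> \<nu>0 \<in> borel_measurable borel \<and>
    (\<forall>q. 0 \<le> \<nu>0 q \<and> \<nu>m \<le> \<nu>0 q \<and> \<nu>0 q \<le> \<nu>p) \<and>
    (\<exists>\<delta>>0. \<exists>\<tau>\<ge>0. \<forall>q v1 v2. \<forall>r\<ge>0. \<forall>l\<ge>0. r - l \<ge> \<tau> \<longrightarrow>
      exp (2 * exponent_integral \<theta> \<nu>0 r q) * V (\<psi> r q v1 - \<psi> r q v2)
        - exp (2 * exponent_integral \<theta> \<nu>0 l q) * V (\<psi> l q v1 - \<psi> l q v2)
      \<le> - \<delta> * integral {l..r} (\<lambda>s. exp (2 * exponent_integral \<theta> \<nu>0 s q)
                                  * (norm (\<iota> (\<psi> s q v1 - \<psi> s q v2)))\<^sup>2))"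

definition uniform_lipschitz ::
  "(real \<Rightarrow> 'q::metric_space \<Rightarrow> 'e::banach \<Rightarrow> 'e) \<Rightarrow> ('e \<Rightarrow> 'h::banach) \<Rightarrow> bool"
  where "uniform_lipschitz \<psi> \<iota> \<longleftrightarrow>
    (\<exists>\<tau>\<ge>0. \<forall>T>0. \<exists>L>0. \<forall>q v1 v2.
      (\<forall>t\<in>{\<tau>..\<tau> + T}. norm (\<psi> t q v1 - \<psi> t q v2) \<le> L * norm (\<iota> (v1 - v2))) \<and>
      (\<forall>t\<in>{0..T}. norm (\<psi> t q v1 - \<psi> t q v2) \<le> L * norm (v1 - v2)))"

(* The infimum is taken in [0, \<infinity>], so that it is \<infinity> for unbounded sets. Boundedness of S is
   required because diameter has no meaningful value otherwise. *)
definition kuratowski_mnc :: "'e::metric_space set \<Rightarrow> ennreal"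
  where "kuratowski_mnc B = Inf {ennreal d | d. d \<ge> 0 \<and>
    (\<exists>F. finite F \<and> B \<subseteq> \<Union>F \<and> (\<forall>S\<in>F. bounded S \<and> diameter S \<le> d))}"

definition asymptotically_compact ::
  "(real \<Rightarrow> 'q::metric_space \<Rightarrow> 'e::banach \<Rightarrow> 'e) \<Rightarrow> real \<Rightarrow> bool"
  where "asymptotically_compact \<psi> \<gamma> \<longleftrightarrow>
    (\<forall>C. compact C \<longrightarrow>
      (\<exists>\<gamma>0 :: real \<Rightarrow> real. (\<forall>t\<ge>0. 0 \<le> \<gamma>0 t) \<and> (\<gamma>0 \<longlongrightarrow> 0) at_top \<and>
        (\<forall>t\<ge>0. \<forall>B. bounded B \<longrightarrow>
          kuratowski_mnc {\<psi> t q v | q v. q \<in> C \<and> v \<in> B}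
            \<le> ennreal (\<gamma>0 t * exp (- \<gamma> * t)) * kuratowski_mnc B)))"

end

theory Submission
  imports Defs
begin

text \<open>
  Let \<open>u\<^sub>k = \<psi>\<^sup>k\<^sup>\<sigma>(q, v\<^sub>0)\<close> be the orbit of the period map. As the base flow is \<open>\<sigma>\<close>-periodic,
  the shift of a trajectory over \<open>q\<close> by \<open>\<sigma>\<close> is again a trajectory over \<open>q\<close>, so that squeezing
  applies to the difference \<open>D(t) = \<psi>\<^sup>t\<^sup>+\<^sup>\<sigma>(q, v\<^sub>0) - \<psi>\<^sup>t(q, v\<^sub>0)\<close>. There are two cases.

  If \<open>V(D)\<close> never becomes negative, squeezing bounds the integral of \<open>e\<^sup>2\<^sup>\<nu> |D|\<^sup>2\<close> over the half-line. The
  smoothing part of the Lipschitz property turns this into pointwise exponential decay of \<open>D\<close>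
  (\<open>decay_of_form_nonneg\<close>), hence \<open>u\<close> is a Cauchy sequence.

  If \<open>V(D)\<close> is negative at some time, it is nonpositive from some time on
  (\<open>form_stays_nonpos\<close>). Because the negative subspace is a line, there is a continuous linear
  functional \<open>f\<close> such that \<open>V(v) \<le> 0\<close> and \<open>f(v) = 0\<close> force \<open>v = 0\<close>
  (\<open>ex_separating_functional\<close>). Hence \<open>f(D)\<close> keeps a strict sign unless \<open>D\<close> vanishes, and \<open>f(u\<^sub>k)\<close> is
  eventually monotone; being bounded, it converges. Going back \<open>n\<close> periods, where the orbit is
  bounded as well, squeezing shows that \<open>V(u\<^sub>k - u\<^sub>m)\<close> is at most of order \<open>e\<^sup>-\<^sup>2\<^sup>\<nu>\<^sup>n\<^sup>\<sigma>\<close> for \<open>k, m \<ge> n\<close>,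
  where \<open>\<nu> > 0\<close> is the lower bound of the exponents. So two limit points \<open>x\<close>, \<open>y\<close> of \<open>u\<close> satisfy
  \<open>V(x - y) \<le> 0\<close> as well as \<open>f(x) = f(y)\<close>, that is \<open>x = y\<close>. The orbit is relatively compact by
  asymptotic compactness (\<open>iterates_relatively_compact\<close>), so it converges.

  In both cases the limit is a fixed point of the period map, its trajectory extends periodically
  to the whole line, and the Lipschitz property on one period carries the convergence over from
  the multiples of \<open>\<sigma>\<close> to all times. Only the real part of the form enters, so real and complex
  scalars are treated alike.
\<close>

section \<open>The real form behind a symmetric operator\<close>

lemma to_complex_scaleR: "to_complex (r *\<^sub>R a) = complex_of_real r * to_complex a"
  for a :: "'k::real_or_complex"
proof -
  have "to_complex (r *\<^sub>R a) = to_complex ((r *\<^sub>R 1) * a)"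
    by simp
  then show ?thesis
    by (simp only: to_complex_mult to_complex_scaleR_one)
qed

definition real_form :: "('e::banach \<Rightarrow>\<^sub>L ('e \<Rightarrow>\<^sub>L 'k::real_or_complex)) \<Rightarrow> 'e \<Rightarrow> 'e \<Rightarrow> real"
  where "real_form P v w = Re (to_complex (P v w))"

lemma quadratic_form_eq_real_form: "quadratic_form P v = real_form P v v"
  by (simp add: quadratic_form_def real_form_def)

lemma bounded_bilinear_real_form: "bounded_bilinear (real_form P)"
proof
  fix a a' b b' and r :: real
  show "real_form P (a + a') b = real_form P a b + real_form P a' b"
    and "real_form P a (b + b') = real_form P a b + real_form P a b'"
    by (simp_all add: real_form_def blinfun.add_left blinfun.add_right to_complex_add)
  show "real_form P (r *\<^sub>R a) b = r *\<^sub>R real_form P a b"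
    and "real_form P a (r *\<^sub>R b) = r *\<^sub>R real_form P a b"
    by (simp_all add: real_form_def blinfun.scaleR_left blinfun.scaleR_right to_complex_scaleR)
  show "\<exists>K. \<forall>a b. norm (real_form P a b) \<le> norm a * norm b * K"
  proof (intro exI allI)
    fix a b
    have "norm (real_form P a b) \<le> norm (to_complex (P a b))"
      by (simp add: real_form_def abs_Re_le_cmod)
    also have "\<dots> = norm (P a b)"
      by (rule norm_to_complex)
    also have "\<dots> \<le> norm (P a) * norm b"
      by (rule norm_blinfun)
    also have "\<dots> \<le> norm P * norm a * norm b"
      by (intro mult_right_mono norm_blinfun norm_ge_zero)
    finally show "norm (real_form P a b) \<le> norm a * norm b * norm P"
      by (simp add: ac_simps)
  qed
qed

lemma real_form_commute:
  assumes "symmetric_operator P"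
  shows "real_form P v w = real_form P w v"
proof -
  have "P v w = rc_cnj (P w v)"
    using assms unfolding symmetric_operator_def by blast
  then have "to_complex (P v w) = cnj (to_complex (P w v))"
    by (simp only: to_complex_cnj)
  then show ?thesis
    unfolding real_form_def by simp
qed

text \<open>
  The projection onto the negative line along the given complement need not be known to be
  continuous, so it is replaced by the functional \<open>B \<cdot> e\<close> for a vector \<open>e\<close> of the
  negative line: the form is positive on the kernel of this functional too. Indeed, if \<open>v\<close> is in
  the kernel and \<open>v = a + c e\<close> with \<open>a\<close> in the positive subspace, then orthogonality gives
  \<open>B a a = B v v + c\<^sup>2 B e e\<close>, and this is not positive if \<open>B v v\<close> is not.
\<close>

lemma ex_separating_functional:
  fixes B :: "'e::real_normed_vector \<Rightarrow> 'e \<Rightarrow> real"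
  assumes "bounded_bilinear B"
    and sym: "\<And>v w. B v w = B w v"
    and dec: "direct_sum_decomposition Ep Em"
    and dim: "dim Em = 1"
    and pos: "\<And>v. v \<in> Ep \<Longrightarrow> v \<noteq> 0 \<Longrightarrow> B v v > 0"
    and neg: "\<And>v. v \<in> Em \<Longrightarrow> v \<noteq> 0 \<Longrightarrow> B v v < 0"
  obtains e where "\<And>v. B v v \<le> 0 \<Longrightarrow> B v e = 0 \<Longrightarrow> v = 0"
proof -
  interpret B: bounded_bilinear B by fact
  obtain S where S: "S \<subseteq> Em" "independent S" "Em \<subseteq> span S" "card S = 1"
    using basis_exists[of Em] dim by metis
  then obtain e where Se: "S = {e}"
    by (auto simp: card_1_singleton_iff)
  with S have e: "e \<in> Em" "e \<noteq> 0" "Em \<subseteq> span {e}"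
    by auto
  show thesis
  proof (rule that)
    fix v assume v: "B v v \<le> 0" "B v e = 0"
    obtain a b where ab: "a \<in> Ep" "b \<in> Em" "v = a + b"
      using dec unfolding direct_sum_decomposition_def by blast
    then obtain c where c: "b = c *\<^sub>R e"
      using e by (auto simp: span_singleton)
    have a: "a = v - c *\<^sub>R e"
      using ab c by simp
    have "B a a = B v v + c\<^sup>2 * B e e"
      using v(2) sym[of e v]
      by (simp add: a B.diff_left B.diff_right B.scaleR_left B.scaleR_right power2_eq_square)
    also have "\<dots> \<le> 0"
      using v(1) neg[OF e(1,2)] by (smt (verit) mult_nonneg_nonpos zero_le_power2)
    finally have "a = 0"
      using pos[OF ab(1)] by force
    then have "c * B e e = 0"
      using v(2) ab c by (simp add: B.scaleR_left)
    then show "v = 0"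
      using neg[OF e(1,2)] ab c \<open>a = 0\<close> by auto
  qed
qed

section \<open>Measure of noncompactness\<close>

lemma kuratowski_mnc_bounded:
  assumes "bounded B"
  shows "kuratowski_mnc B < \<infinity>"
proof -
  have "kuratowski_mnc B \<le> ennreal (diameter B)"
    unfolding kuratowski_mnc_def
    by (rule Inf_lower) (use assms in \<open>auto intro!: exI[of _ "{B}"] exI[of _ "diameter B"] diameter_ge_0\<close>)
  then show ?thesis
    by (simp add: le_less_trans)
qed

text \<open>
  A finite set can be covered by singletons, which are bounded sets of diameter zero.
\<close>

lemma kuratowski_mnc_union_finite:
  assumes "finite A"
  shows "kuratowski_mnc (A \<union> B) \<le> kuratowski_mnc B"
  unfolding kuratowski_mnc_def
proof (rule Inf_superset_mono, safe)
  fix d :: real and F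
  assume F: "d \<ge> 0" "finite F" "B \<subseteq> \<Union>F" "\<forall>S\<in>F. bounded S \<and> diameter S \<le> d"
  then show "\<exists>d'. ennreal d = ennreal d' \<and> 0 \<le> d' \<and>
      (\<exists>F. finite F \<and> A \<union> B \<subseteq> \<Union>F \<and> (\<forall>S\<in>F. bounded S \<and> diameter S \<le> d'))"
    using assms
    by (intro exI[of _ d] conjI exI[of _ "F \<union> (\<lambda>x. {x}) ` A"]) auto
qed

lemma compact_closure_of_kuratowski_mnc_zero:
  fixes B :: "'e::complete_space set"
  assumes "kuratowski_mnc B = 0"
  shows "compact (closure B)"
proof -
  have "\<exists>K. finite K \<and> closure B \<subseteq> (\<Union>x\<in>K. ball x e)" if "e > 0" for e
  proof -
    have "kuratowski_mnc B < ennreal (e / 2)"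
      using assms that by simp
    then obtain d F where F: "d \<ge> 0" "ennreal d < ennreal (e / 2)" "finite F" "B \<subseteq> \<Union>F"
        "\<forall>S\<in>F. bounded S \<and> diameter S \<le> d"
      unfolding kuratowski_mnc_def by (auto simp: Inf_less_iff)
    then have d: "d < e / 2"
      by (simp add: ennreal_less_iff)
    define c where "c S = (SOME x. x \<in> S)" for S :: "'e set"
    have "S \<subseteq> cball (c S) (e / 2)" if "S \<in> F" for S
    proof
      fix x assume "x \<in> S"
      then have "c S \<in> S"
        unfolding c_def by (rule someI)
      then have "dist (c S) x \<le> diameter S"
        using F that \<open>x \<in> S\<close> by (intro diameter_bounded_bound) auto
      then show "x \<in> cball (c S) (e / 2)"
        using F(5) that d by force
    qed
    then have "B \<subseteq> (\<Union>S\<in>F. cball (c S) (e / 2))"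
      using F(4) by blast
    then have "closure B \<subseteq> (\<Union>S\<in>F. cball (c S) (e / 2))"
      using F(3) by (intro closure_minimal) auto
    also have "\<dots> \<subseteq> (\<Union>x\<in>c ` F. ball x e)"
      using \<open>e > 0\<close> by auto
    finally show ?thesis
      using F(3) by blast
  qed
  then show ?thesis
    by (simp add: compact_eq_totally_bounded complete_eq_closed)
qed

text \<open>
  Uniqueness is asked for pairs of subsequences, and not for cluster points in the abstract, since
  estimates on the limits use that the indices along a subsequence grow.
\<close>

lemma compact_sequence_convergent:
  fixes u :: "nat \<Rightarrow> 'e::metric_space"
  assumes "compact K" and "\<And>k. u k \<in> K"
    and unique: "\<And>r s x y. strict_mono r \<Longrightarrow> strict_mono s \<Longrightarrow>
      (u \<circ> r) \<longlonglongrightarrow> x \<Longrightarrow> (u \<circ> s) \<longlonglongrightarrow> y \<Longrightarrow> x = y"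
  shows "convergent u"
proof -
  have sub: "\<exists>x s. strict_mono s \<and> ((u \<circ> r) \<circ> s) \<longlonglongrightarrow> x" for r :: "nat \<Rightarrow> nat"
    using assms(1,2) unfolding compact_def by (metis comp_apply)
  obtain x s where s: "strict_mono s" "(u \<circ> s) \<longlonglongrightarrow> x"
    using sub[of id] by auto
  have "u \<longlonglongrightarrow> x"
  proof (rule ccontr)
    assume "\<not> u \<longlonglongrightarrow> x"
    then obtain e where e: "e > 0" "\<exists>\<^sub>F n in sequentially. \<not> dist (u n) x < e"
      by (auto simp: tendsto_iff not_eventually)
    then have "infinite {n. \<not> dist (u n) x < e}"
      by (simp add: frequently_cofinite cofinite_eq_sequentially[symmetric])
    from infinite_enumerate[OF this] obtain r :: "nat \<Rightarrow> nat"
      where r: "strict_mono r" "\<And>n. \<not> dist (u (r n)) x < e"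
      by auto
    obtain y s' where s': "strict_mono s'" "((u \<circ> r) \<circ> s') \<longlonglongrightarrow> y"
      using sub[of r] by auto
    have "y = x"
      using unique[of "r \<circ> s'" s y x] s s' r(1) by (simp add: strict_mono_o comp_assoc)
    then have "\<forall>\<^sub>F n in sequentially. dist (((u \<circ> r) \<circ> s') n) x < e"
      using s'(2) e(1) by (simp add: tendsto_iff)
    then show False
      using r(2) by (auto simp: eventually_sequentially)
  qed
  then show ?thesis
    by (rule convergentI)
qed

section \<open>Squeezed cocycles over a periodic flow\<close>

text \<open>
  \<open>V\<close> stands for the quadratic form. Its algebraic and metric properties are hypotheses of the
  lemmas that compare different trajectories in the limit; the decay estimates come from squeezing.
\<close>

locale squeezed_periodic_cocycle =
  fixes \<theta> :: "real \<Rightarrow> 'q::complete_space \<Rightarrow> 'q"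
    and \<psi> :: "real \<Rightarrow> 'q \<Rightarrow> 'e::banach \<Rightarrow> 'e"
    and \<iota> :: "'e \<Rightarrow> 'h::banach"
    and V :: "'e \<Rightarrow> real"
    and \<nu>m \<nu>p \<sigma> :: real
    and \<nu>0 :: "'q \<Rightarrow> real"
  assumes period_pos: "\<sigma> > 0"
    and flow: "flow \<theta>"
    and periodic: "\<theta> \<sigma> = id"
    and cocycle: "cocycle \<theta> \<psi>"
    and continuous_iota: "continuous_on UNIV \<iota>"
    and squeezing: "squeezing \<theta> \<psi> \<iota> V \<nu>m \<nu>p \<nu>0"
    and continuous_exponent: "continuous_on UNIV \<nu>0"
    and exponent_pos: "\<nu>m > 0"
    and lipschitz: "uniform_lipschitz \<psi> \<iota>"
begin

lemma flow_add_periods: "\<theta> (s + real n * \<sigma>) = \<theta> s"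
proof (induction n)
  case (Suc n)
  have "\<theta> (s + real (Suc n) * \<sigma>) = \<theta> ((s + real n * \<sigma>) + \<sigma>)"
    by (simp add: algebra_simps)
  also have "\<dots> = \<theta> (s + real n * \<sigma>) \<circ> \<theta> \<sigma>"
    using flow unfolding flow_def by blast
  finally show ?case
    using Suc periodic by simp
qed simp

lemma flow_periods: "\<theta> (real n * \<sigma>) = id"
  using flow_add_periods[of 0 n] flow by (simp add: flow_def)

lemma cocycle_zero: "\<psi> 0 q v = v"
  using cocycle by (simp add: cocycle_def)

lemma cocycle_add: "t \<ge> 0 \<Longrightarrow> s \<ge> 0 \<Longrightarrow> \<psi> (t + s) q v = \<psi> t (\<theta> s q) (\<psi> s q v)"
  using cocycle by (simp add: cocycle_def)

text \<open>
  The base point is the same on both sides: a trajectory over \<open>q\<close>, shifted by whole periods, is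
  again a trajectory over \<open>q\<close> and so can be compared with the original one.
\<close>

lemma cocycle_add_periods:
  "t \<ge> 0 \<Longrightarrow> \<psi> (t + real n * \<sigma>) q v = \<psi> t q (\<psi> (real n * \<sigma>) q v)"
  using cocycle_add[of t "real n * \<sigma>" q v] period_pos by (simp add: flow_periods)

lemma iterate_add:
  "\<psi> (real n * \<sigma>) q (\<psi> (real k * \<sigma>) q v) = \<psi> (real (n + k) * \<sigma>) q v"
  using cocycle_add_periods[of "real n * \<sigma>" k q v] period_pos by (simp add: algebra_simps)

lemma filterlim_periods: "filterlim (\<lambda>n. real n * \<sigma>) at_top sequentially"
  using period_pos
  by (subst mult.commute) (intro filterlim_tendsto_pos_mult_at_top[OF tendsto_const]
    filterlim_real_sequentially)

lemma cocycle_eq_persists: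
  assumes "\<psi> s q v1 = \<psi> s q v2" and "s \<ge> 0" and "t \<ge> s"
  shows "\<psi> t q v1 = \<psi> t q v2"
  using assms cocycle_add[of "t - s" s q v1] cocycle_add[of "t - s" s q v2] by simp

lemma continuous_on_flow: "continuous_on S (\<lambda>s. \<theta> s q)"
proof -
  have "continuous_on UNIV (\<lambda>(t, q). \<theta> t q)"
    using flow by (simp add: flow_def)
  from continuous_on_compose2[OF this, of S "\<lambda>s. (s, q)"] show ?thesis
    by (simp add: continuous_on_Pair)
qed

lemma continuous_on_trajectory: "continuous_on {0..} (\<lambda>t. \<psi> t q v)"
proof -
  have "continuous_on ({0..} \<times> UNIV \<times> UNIV) (\<lambda>(t, q, v). \<psi> t q v)"
    using cocycle by (simp add: cocycle_def)
  from continuous_on_compose2[OF this, of "{0..}" "\<lambda>t. (t, q, v)"] show ?thesis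
    by (simp add: continuous_on_Pair image_subset_iff)
qed

lemma continuous_on_cocycle: "t \<ge> 0 \<Longrightarrow> continuous_on UNIV (\<lambda>v. \<psi> t q v)"
proof -
  assume "t \<ge> 0"
  have "continuous_on ({0..} \<times> UNIV \<times> UNIV) (\<lambda>(t, q, v). \<psi> t q v)"
    using cocycle by (simp add: cocycle_def)
  from continuous_on_compose2[OF this, of UNIV "\<lambda>v. (t, q, v)"] \<open>t \<ge> 0\<close> show ?thesis
    by (simp add: continuous_on_Pair image_subset_iff)
qed

abbreviation \<nu> :: "'q \<Rightarrow> real \<Rightarrow> real"
  where "\<nu> q t \<equiv> exponent_integral \<theta> \<nu>0 t q"

lemma exponent_zero: "\<nu> q 0 = 0"
  by (simp add: exponent_integral_def)

lemma exponent_integrable: "(\<lambda>s. \<nu>0 (\<theta> s q)) integrable_on {a..b}"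
  by (intro integrable_continuous_real continuous_on_compose2[OF continuous_exponent]
      continuous_on_flow) auto

lemma exponent_ge:
  assumes "t \<ge> 0"
  shows "\<nu>m * t \<le> \<nu> q t"
proof -
  have "integral {0..t} (\<lambda>s. \<nu>m) \<le> integral {0..t} (\<lambda>s. \<nu>0 (\<theta> s q))"
    using squeezing by (intro integral_le exponent_integrable) (auto simp: squeezing_def)
  then show ?thesis
    using assms by (simp add: exponent_integral_def mult.commute)
qed

lemma continuous_on_exponent: "continuous_on {0..b} (\<nu> q)"
  unfolding exponent_integral_def
  by (rule indefinite_integral_continuous_1[OF exponent_integrable])

abbreviation weighted_form :: "'q \<Rightarrow> 'e \<Rightarrow> 'e \<Rightarrow> real \<Rightarrow> real"
  where "weighted_form q v1 v2 t \<equiv> exp (2 * \<nu> q t) * V (\<psi> t q v1 - \<psi> t q v2)"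

abbreviation dissipation :: "'q \<Rightarrow> 'e \<Rightarrow> 'e \<Rightarrow> real \<Rightarrow> real"
  where "dissipation q v1 v2 s \<equiv> exp (2 * \<nu> q s) * (norm (\<iota> (\<psi> s q v1 - \<psi> s q v2)))\<^sup>2"

lemma dissipation_integrable:
  assumes "0 \<le> a"
  shows "dissipation q v1 v2 integrable_on {a..b}"
proof (rule integrable_continuous_real)
  have sub: "{a..b} \<subseteq> {0..b}" "{a..b} \<subseteq> {0..}"
    using assms by auto
  show "continuous_on {a..b} (dissipation q v1 v2)"
    by (intro continuous_intros continuous_on_compose2[OF continuous_iota]
        continuous_on_subset[OF continuous_on_exponent sub(1)]
        continuous_on_subset[OF continuous_on_trajectory sub(2)]) auto
qed

lemma dissipation_integral_nonneg: "integral {a..b} (dissipation q v1 v2) \<ge> 0"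
  by (cases "dissipation q v1 v2 integrable_on {a..b}")
    (auto intro!: integral_nonneg simp: not_integrable_integral)

lemma ex_squeezing_delay:
  obtains \<delta> \<tau> where "\<delta> > 0" "\<tau> \<ge> 0"
    "\<And>q v1 v2 l r. l \<ge> 0 \<Longrightarrow> r \<ge> l + \<tau> \<Longrightarrow>
      weighted_form q v1 v2 r + \<delta> * integral {l..r} (dissipation q v1 v2) \<le> weighted_form q v1 v2 l"
proof -
  obtain \<delta> \<tau> where *: "\<delta> > 0" "\<tau> \<ge> 0" "\<forall>q v1 v2. \<forall>r\<ge>0. \<forall>l\<ge>0. r - l \<ge> \<tau> \<longrightarrow>
      weighted_form q v1 v2 r - weighted_form q v1 v2 l
      \<le> - \<delta> * integral {l..r} (dissipation q v1 v2)"
    using squeezing unfolding squeezing_def by blast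
  show thesis
  proof (rule that[OF *(1,2)])
    fix q v1 v2 and l r :: real
    assume "l \<ge> 0" "r \<ge> l + \<tau>"
    with *(2) *(3)[rule_format, of r l q v1 v2]
    show "weighted_form q v1 v2 r + \<delta> * integral {l..r} (dissipation q v1 v2) \<le> weighted_form q v1 v2 l"
      by simp
  qed
qed

lemma ex_monotonicity_delay:
  obtains \<tau> where "\<tau> \<ge> 0"
    "\<And>q v1 v2 l r. l \<ge> 0 \<Longrightarrow> r \<ge> l + \<tau> \<Longrightarrow> weighted_form q v1 v2 r \<le> weighted_form q v1 v2 l"
proof -
  obtain \<delta> \<tau> where *: "\<delta> > 0" "\<tau> \<ge> 0" "\<And>q v1 v2 l r. l \<ge> 0 \<Longrightarrow> r \<ge> l + \<tau> \<Longrightarrow>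
      weighted_form q v1 v2 r + \<delta> * integral {l..r} (dissipation q v1 v2) \<le> weighted_form q v1 v2 l"
    using ex_squeezing_delay by blast
  show thesis
  proof (rule that[OF *(2)])
    fix q v1 v2 and l r :: real
    assume "l \<ge> 0" "r \<ge> l + \<tau>"
    with *(3)[of l r q v1 v2]
      mult_nonneg_nonneg[OF less_imp_le[OF *(1)] dissipation_integral_nonneg[of l r q v1 v2]]
    show "weighted_form q v1 v2 r \<le> weighted_form q v1 v2 l"
      by linarith
  qed
qed

lemma form_stays_nonpos:
  assumes "l \<ge> 0" and "V (\<psi> l q v1 - \<psi> l q v2) \<le> 0"
  shows "\<forall>\<^sub>F t in at_top. V (\<psi> t q v1 - \<psi> t q v2) \<le> 0"
proof -
  obtain \<tau> where "\<tau> \<ge> 0" and mono: "\<And>q v1 v2 l r. l \<ge> 0 \<Longrightarrow> r \<ge> l + \<tau> \<Longrightarrow>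
      weighted_form q v1 v2 r \<le> weighted_form q v1 v2 l"
    using ex_monotonicity_delay by blast
  have "V (\<psi> r q v1 - \<psi> r q v2) \<le> 0" if "r \<ge> l + \<tau>" for r
  proof -
    have "weighted_form q v1 v2 r \<le> weighted_form q v1 v2 l"
      using assms(1) that by (rule mono)
    also have "\<dots> \<le> 0"
      using assms(2) by (simp add: mult_nonneg_nonpos)
    finally show ?thesis
      by (simp add: mult_le_0_iff)
  qed
  then show ?thesis
    by (auto simp: eventually_at_top_linorder)
qed

text \<open>
  The weighted form does not exceed its initial value \<open>V(v\<^sub>1 - v\<^sub>2)\<close>, and the weight is at least
  \<open>e\<^sup>2\<^sup>\<nu>\<^sup>t\<close> for the lower bound \<open>\<nu>\<close> of the exponents. Replacing the weight by this bound needs a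
  positive form at time \<open>t\<close>; otherwise the estimate holds because its right-hand side, with the
  absolute value, is nonnegative.
\<close>

lemma form_decay:
  "\<forall>\<^sub>F t in at_top. \<forall>q v1 v2.
    V (\<psi> t q v1 - \<psi> t q v2) \<le> exp (- 2 * \<nu>m * t) * \<bar>V (v1 - v2)\<bar>"
proof -
  obtain \<tau> where "\<tau> \<ge> 0" and mono: "\<And>q v1 v2 l r. l \<ge> 0 \<Longrightarrow> r \<ge> l + \<tau> \<Longrightarrow>
      weighted_form q v1 v2 r \<le> weighted_form q v1 v2 l"
    using ex_monotonicity_delay by blast
  have "V (\<psi> r q v1 - \<psi> r q v2) \<le> exp (- 2 * \<nu>m * r) * \<bar>V (v1 - v2)\<bar>" if "r \<ge> \<tau>" for r q v1 v2
  proof (cases "V (\<psi> r q v1 - \<psi> r q v2) \<le> 0")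
    case True
    then show ?thesis
      by (rule order_trans) simp
  next
    case False
    have "exp (2 * \<nu>m * r) * V (\<psi> r q v1 - \<psi> r q v2) \<le> weighted_form q v1 v2 r"
      using False exponent_ge[of r q] that \<open>\<tau> \<ge> 0\<close> by (intro mult_right_mono) auto
    also have "\<dots> \<le> V (v1 - v2)"
      using mono[of 0 r q v1 v2] that by (simp add: exponent_zero cocycle_zero)
    also have "\<dots> \<le> \<bar>V (v1 - v2)\<bar>"
      by simp
    finally show ?thesis
      by (simp add: exp_minus field_simps)
  qed
  then show ?thesis
    unfolding eventually_at_top_linorder by blast
qed

text \<open>
  As the weighted form starts at \<open>V(v\<^sub>1 - v\<^sub>2)\<close> and stays nonnegative, squeezing bounds the weighted
  integral of the squared Hilbert norm of the difference, uniformly in time. The Banach norm at time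
  \<open>t\<close> is controlled by the Hilbert norm at every time of a window of length one that precedes \<open>t\<close> by
  the smoothing delay; the part of the integral over this window therefore bounds the square of the
  Banach norm, and the weight there supplies the exponential factor.
\<close>

lemma decay_of_form_nonneg:
  assumes nonneg: "\<And>t. t \<ge> 0 \<Longrightarrow> V (\<psi> t q v1 - \<psi> t q v2) \<ge> 0"
  obtains C where "\<forall>\<^sub>F t in at_top. norm (\<psi> t q v1 - \<psi> t q v2) \<le> C * exp (- \<nu>m * t)"
proof -
  obtain \<delta> \<tau> where *: "\<delta> > 0" "\<tau> \<ge> 0" "\<And>q v1 v2 l r. l \<ge> 0 \<Longrightarrow> r \<ge> l + \<tau> \<Longrightarrow>
      weighted_form q v1 v2 r + \<delta> * integral {l..r} (dissipation q v1 v2) \<le> weighted_form q v1 v2 l"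
    using ex_squeezing_delay by blast
  obtain \<tau>' where \<tau>': "\<tau>' \<ge> 0" "\<forall>T>0. \<exists>L>0. \<forall>q v1 v2.
      (\<forall>t\<in>{\<tau>'..\<tau>' + T}. norm (\<psi> t q v1 - \<psi> t q v2) \<le> L * norm (\<iota> (v1 - v2))) \<and>
      (\<forall>t\<in>{0..T}. norm (\<psi> t q v1 - \<psi> t q v2) \<le> L * norm (v1 - v2))"
    using lipschitz unfolding uniform_lipschitz_def by blast
  from \<tau>'(2)[rule_format, of 1] obtain L where L: "L > 0"
    "\<And>q v1 v2 t. t \<in> {\<tau>'..\<tau>' + 1} \<Longrightarrow>
       norm (\<psi> t q v1 - \<psi> t q v2) \<le> L * norm (\<iota> (v1 - v2))"
    by auto
  define M where "M = V (v1 - v2) / \<delta>"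
  define D where "D t = norm (\<psi> t q v1 - \<psi> t q v2)" for t
  have "D t \<le> (L * sqrt M * exp (\<nu>m * (\<tau>' + 1))) * exp (- \<nu>m * t)" if t: "t \<ge> \<tau> + \<tau>' + 1" for t
  proof -
    \<comment> \<open>start of the window \<open>[a, a + 1]\<close>, all of whose times lie between \<open>\<tau>'\<close> and \<open>\<tau>' + 1\<close> before \<open>t\<close>\<close>
    define a where "a = t - \<tau>' - 1"
    have a: "a \<ge> 0" "a + 1 \<le> t" "t - \<tau>' = a + 1"
      using t *(2) \<tau>'(1) by (auto simp: a_def)
    have lower: "(exp (\<nu>m * a) * (D t / L))\<^sup>2 \<le> dissipation q v1 v2 s" if s: "s \<in> {a..a + 1}" for s
    proof -
      have "D t = norm (\<psi> (t - s) (\<theta> s q) (\<psi> s q v1) - \<psi> (t - s) (\<theta> s q) (\<psi> s q v2))"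
        using cocycle_add[of "t - s" s q v1] cocycle_add[of "t - s" s q v2] s a
        by (simp add: D_def)
      also have "\<dots> \<le> L * norm (\<iota> (\<psi> s q v1 - \<psi> s q v2))"
        using s by (intro L(2)) (simp add: a_def)
      finally have "D t / L \<le> norm (\<iota> (\<psi> s q v1 - \<psi> s q v2))"
        using L(1) by (simp add: field_simps)
      then have 1: "(D t / L)\<^sup>2 \<le> (norm (\<iota> (\<psi> s q v1 - \<psi> s q v2)))\<^sup>2"
        using L(1) by (intro power_mono) (auto simp: D_def)
      have "\<nu>m * a \<le> \<nu>m * s"
        using s exponent_pos by simp
      also have "\<dots> \<le> \<nu> q s"
        using s a by (intro exponent_ge) auto
      finally have 2: "(exp (\<nu>m * a))\<^sup>2 \<le> exp (2 * \<nu> q s)"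
        by (simp flip: exp_double)
      show ?thesis
        unfolding power_mult_distrib using 1 2 by (intro mult_mono) auto
    qed
    have "(exp (\<nu>m * a) * (D t / L))\<^sup>2 = integral {a..a + 1} (\<lambda>s. (exp (\<nu>m * a) * (D t / L))\<^sup>2)"
      by simp
    also have "\<dots> \<le> integral {a..a + 1} (dissipation q v1 v2)"
      using lower a by (intro integral_le dissipation_integrable) auto
    also have "\<dots> \<le> integral {0..t} (dissipation q v1 v2)"
      using a by (intro integral_subset_le dissipation_integrable) auto
    also have "\<dots> \<le> M"
    proof -
      have "t \<ge> \<tau>" "t \<ge> 0"
        using t \<tau>'(1) *(2) by auto
      then have "\<delta> * integral {0..t} (dissipation q v1 v2) \<le> V (v1 - v2)"
        using *(3)[of 0 t q v1 v2] mult_nonneg_nonneg[OF exp_ge_zero[of "2 * \<nu> q t"] nonneg[of t]]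
        by (simp add: exponent_zero cocycle_zero)
      then show ?thesis
        using *(1) by (simp add: M_def field_simps)
    qed
    finally have "exp (\<nu>m * a) * (D t / L) \<le> sqrt M"
      by (rule real_le_rsqrt)
    then have "D t \<le> L * sqrt M * exp (- (\<nu>m * a))"
      using L(1) by (simp add: exp_minus field_simps)
    also have "exp (- (\<nu>m * a)) = exp (\<nu>m * (\<tau>' + 1)) * exp (- \<nu>m * t)"
      unfolding a_def by (simp flip: exp_add add: algebra_simps)
    finally show ?thesis
      by (simp add: ac_simps)
  qed
  then show thesis
    by (intro that[of "L * sqrt M * exp (\<nu>m * (\<tau>' + 1))"])
      (auto simp: eventually_at_top_linorder D_def)
qed

text \<open>
  For negative times the trajectory is read off from its forward continuation after sufficiently
  many periods; the value does not depend on their number, since the starting point is fixed by the period map.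
\<close>

lemma trajectory_of_fixed_point:
  assumes fixed: "\<psi> \<sigma> q x = x"
  obtains w where "complete_trajectory \<theta> \<psi> q w" "\<And>t. w (t + \<sigma>) = w t"
    "\<And>t. t \<ge> 0 \<Longrightarrow> w t = \<psi> t q x"
proof -
  have shift: "\<psi> (t + real n * \<sigma>) q x = \<psi> t q x" if "t \<ge> 0" for t n
  proof (induction n)
    case (Suc n)
    have "\<psi> (t + real (Suc n) * \<sigma>) q x = \<psi> ((t + real n * \<sigma>) + real 1 * \<sigma>) q x"
      by (simp add: algebra_simps)
    also have "\<dots> = \<psi> (t + real n * \<sigma>) q x"
      using that period_pos fixed by (subst cocycle_add_periods) auto
    finally show ?case
      using Suc by simp
  qed simp
  \<comment> \<open>one number of periods that makes the time nonnegative; the fact \<open>w\<close> allows every such number\<close>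
  define w where "w t = \<psi> (t + real (nat \<lceil>\<bar>t\<bar> / \<sigma>\<rceil>) * \<sigma>) q x" for t
  have w: "w t = \<psi> (t + real n * \<sigma>) q x" if "t + real n * \<sigma> \<ge> 0" for t n
  proof -
    define m where "m = nat \<lceil>\<bar>t\<bar> / \<sigma>\<rceil>"
    have "\<bar>t\<bar> / \<sigma> \<le> real m"
      unfolding m_def by linarith
    then have m: "t + real m * \<sigma> \<ge> 0"
      using period_pos by (simp add: field_simps)
    have "\<psi> (t + real m * \<sigma>) q x = \<psi> (t + real m * \<sigma> + real n * \<sigma>) q x"
      using shift[OF m] by simp
    also have "\<dots> = \<psi> (t + real n * \<sigma> + real m * \<sigma>) q x"
      by (simp add: ac_simps)
    also have "\<dots> = \<psi> (t + real n * \<sigma>) q x"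
      by (rule shift[OF that])
    finally show ?thesis
      by (simp add: w_def m_def)
  qed
  have ex_large: "\<exists>n. t + real n * \<sigma> > 0" for t
  proof -
    obtain n where "- t < real n * \<sigma>"
      using reals_Archimedean3[OF period_pos] by blast
    then show ?thesis
      by (intro exI[of _ n]) simp
  qed
  show thesis
  proof (rule that)
    show "w t = \<psi> t q x" if "t \<ge> 0" for t
      using w[of t 0] that by simp
    show "w (t + \<sigma>) = w t" for t
    proof -
      obtain n where n: "t + real n * \<sigma> > 0"
        using ex_large by blast
      then have "w (t + \<sigma>) = \<psi> (t + \<sigma> + real n * \<sigma>) q x"
        using period_pos by (intro w) simp
      also have "t + \<sigma> + real n * \<sigma> = t + real (Suc n) * \<sigma>"
        by (simp add: algebra_simps)
      also have "\<psi> (t + real (Suc n) * \<sigma>) q x = w t"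
        using n period_pos by (intro w[symmetric]) (simp add: algebra_simps)
      finally show ?thesis .
    qed
    show "complete_trajectory \<theta> \<psi> q w"
      unfolding complete_trajectory_def
    proof (intro conjI allI impI)
      show "continuous_on UNIV w"
        unfolding continuous_on_eq_continuous_at[OF open_UNIV]
      proof
        fix t
        obtain n where n: "t + real n * \<sigma> > 0"
          using ex_large by blast
        let ?U = "{- (real n * \<sigma>)<..}"
        have "continuous_on ?U (\<lambda>t. \<psi> (t + real n * \<sigma>) q x)"
          by (rule continuous_on_compose2[OF continuous_on_trajectory])
            (auto intro!: continuous_intros)
        then have "continuous_on ?U w"
          by (rule continuous_on_eq) (auto intro!: w[symmetric])
        then show "isCont w t"
          using n by (auto simp: continuous_on_eq_continuous_at)
      qed
      fix t s :: real assume "t \<ge> 0"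
      obtain n where n: "s + real n * \<sigma> > 0"
        using ex_large by blast
      have "w (t + s) = \<psi> (t + (s + real n * \<sigma>)) q x"
        using w[of "t + s" n] n \<open>t \<ge> 0\<close> by (simp add: add.assoc)
      also have "\<dots> = \<psi> t (\<theta> s q) (w s)"
        using n \<open>t \<ge> 0\<close> w[of s n] by (simp add: cocycle_add flow_add_periods)
      finally show "w (t + s) = \<psi> t (\<theta> s q) (w s)" .
    qed
  qed
qed

text \<open>
  Every time is a number of full periods plus a remainder in \<open>[0, \<sigma>]\<close>, and on this interval the
  cocycle is Lipschitz with one constant over all base points.
\<close>

lemma convergence_of_convergent_period_map:
  assumes "(\<lambda>k. \<psi> (real k * \<sigma>) q v) \<longlonglongrightarrow> x"
  shows "\<exists>w. complete_trajectory \<theta> \<psi> q w \<and> (\<forall>t. w (t + \<sigma>) = w t) \<and>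
    ((\<lambda>t. norm (\<psi> t q v - w t)) \<longlongrightarrow> 0) at_top"
proof -
  define u where "u k = \<psi> (real k * \<sigma>) q v" for k
  have u: "u \<longlonglongrightarrow> x"
    using assms by (simp add: u_def[abs_def])
  have "(\<lambda>k. \<psi> \<sigma> q (u k)) \<longlonglongrightarrow> \<psi> \<sigma> q x"
    using continuous_on_cocycle[of \<sigma> q] period_pos u
    by (intro continuous_on_tendsto_compose[of UNIV "\<psi> \<sigma> q"]) auto
  moreover have "\<psi> \<sigma> q (u k) = u (Suc k)" for k
    using cocycle_add_periods[of \<sigma> k q v] period_pos by (simp add: u_def algebra_simps)
  ultimately have "(\<lambda>k. u (Suc k)) \<longlonglongrightarrow> \<psi> \<sigma> q x"
    by simp
  then have fixed: "\<psi> \<sigma> q x = x"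
    using LIMSEQ_unique LIMSEQ_Suc[OF u] by blast
  obtain w where w: "complete_trajectory \<theta> \<psi> q w" "\<And>t. w (t + \<sigma>) = w t"
    "\<And>t. t \<ge> 0 \<Longrightarrow> w t = \<psi> t q x"
    using trajectory_of_fixed_point[OF fixed] by blast
  obtain L where L: "L > 0" "\<And>q v1 v2 t. t \<in> {0..\<sigma>} \<Longrightarrow>
       norm (\<psi> t q v1 - \<psi> t q v2) \<le> L * norm (v1 - v2)"
    using lipschitz period_pos unfolding uniform_lipschitz_def by meson
  have w_periods: "w (t + real n * \<sigma>) = w t" for t n
  proof (induction n)
    case (Suc n)
    then show ?case
      using w(2)[of "t + real n * \<sigma>"] by (simp add: algebra_simps)
  qed simp
  define k where "k t = nat \<lfloor>t / \<sigma>\<rfloor>" for t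
  have "norm (\<psi> t q v - w t) \<le> L * norm (u (k t) - x)" if "t \<ge> 0" for t
  proof -
    define s where "s = t - real (k t) * \<sigma>"
    have "real (k t) = \<lfloor>t / \<sigma>\<rfloor>"
      using that period_pos by (simp add: k_def)
    then have "real (k t) \<le> t / \<sigma>" "t / \<sigma> \<le> real (k t) + 1"
      by linarith+
    then have s: "s \<in> {0..\<sigma>}" "t = s + real (k t) * \<sigma>"
      using period_pos by (auto simp: s_def field_simps)
    have "\<psi> t q v = \<psi> s q (u (k t))"
      using s(1) cocycle_add_periods[of s "k t" q v] by (simp flip: s(2) add: u_def)
    moreover have "w t = \<psi> s q x"
      using s(1) w(3)[of s] w_periods[of s "k t"] by (simp flip: s(2))
    ultimately show ?thesis
      using L(2)[OF s(1)] by simp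
  qed
  then have "\<forall>\<^sub>F t in at_top. norm (norm (\<psi> t q v - w t)) \<le> L * norm (u (k t) - x)"
    by (auto intro!: eventually_mono[OF eventually_ge_at_top[of 0]])
  moreover have "((\<lambda>t. L * norm (u (k t) - x)) \<longlongrightarrow> 0) at_top"
  proof -
    have "filterlim k sequentially at_top"
      unfolding filterlim_at_top
    proof
      fix n
      have "n \<le> k t" if "t \<ge> real n * \<sigma>" for t
      proof -
        have "real n \<le> t / \<sigma>"
          using that period_pos by (simp add: field_simps)
        then show ?thesis
          unfolding k_def by (simp add: le_nat_floor)
      qed
      then show "\<forall>\<^sub>F t in at_top. n \<le> k t"
        by (auto simp: eventually_at_top_linorder)
    qed
    then have "((\<lambda>t. u (k t)) \<longlongrightarrow> x) at_top"
      using filterlim_compose[OF u] by blast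
    then show ?thesis
      by (auto intro!: tendsto_eq_intros)
  qed
  ultimately have "((\<lambda>t. norm (\<psi> t q v - w t)) \<longlongrightarrow> 0) at_top"
    by (rule Lim_null_comparison)
  with w show ?thesis
    by blast
qed

text \<open>
  The differences of the bounded sequence of iterates \<open>n\<close> periods earlier have bounded form, and
  over the last \<open>n\<close> periods the form decays exponentially.
\<close>

lemma form_of_iterates_decay:
  assumes "\<And>v. \<bar>V v\<bar> \<le> K * (norm v)\<^sup>2" and "K \<ge> 0"
    and R: "\<And>k. norm (\<psi> (real k * \<sigma>) q v) \<le> R"
  shows "\<forall>\<^sub>F n in sequentially. \<forall>k\<ge>n. \<forall>m\<ge>n.
    V (\<psi> (real k * \<sigma>) q v - \<psi> (real m * \<sigma>) q v)
      \<le> exp (- 2 * \<nu>m * (real n * \<sigma>)) * (K * (2 * R)\<^sup>2)"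
proof -
  define u where "u k = \<psi> (real k * \<sigma>) q v" for k
  have u_add: "\<psi> (real n * \<sigma>) q (u k) = u (n + k)" for n k
    by (simp only: u_def iterate_add)
  have V_le: "\<bar>V (u k - u m)\<bar> \<le> K * (2 * R)\<^sup>2" for k m
  proof -
    have "norm (u k - u m) \<le> 2 * R"
      using R[of k] R[of m] norm_triangle_ineq4[of "u k" "u m"] by (simp add: u_def)
    then have "K * (norm (u k - u m))\<^sup>2 \<le> K * (2 * R)\<^sup>2"
      using \<open>K \<ge> 0\<close> by (intro mult_left_mono power_mono) auto
    then show ?thesis
      using assms(1)[of "u k - u m"] by linarith
  qed
  have "\<forall>\<^sub>F n in sequentially. \<forall>q v1 v2.
      V (\<psi> (real n * \<sigma>) q v1 - \<psi> (real n * \<sigma>) q v2)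
        \<le> exp (- 2 * \<nu>m * (real n * \<sigma>)) * \<bar>V (v1 - v2)\<bar>"
    by (rule eventually_compose_filterlim[OF form_decay filterlim_periods])
  then show ?thesis
  proof eventually_elim
    case (elim n)
    show ?case
    proof (intro allI impI)
      fix k m assume "n \<le> k" "n \<le> m"
      then have "V (u k - u m) = V (\<psi> (real n * \<sigma>) q (u (k - n)) - \<psi> (real n * \<sigma>) q (u (m - n)))"
        by (simp add: u_add)
      also have "\<dots> \<le> exp (- 2 * \<nu>m * (real n * \<sigma>)) * \<bar>V (u (k - n) - u (m - n))\<bar>"
        using elim by blast
      also have "\<dots> \<le> exp (- 2 * \<nu>m * (real n * \<sigma>)) * (K * (2 * R)\<^sup>2)"
        by (intro mult_left_mono V_le) simp
      finally show "V (\<psi> (real k * \<sigma>) q v - \<psi> (real m * \<sigma>) q v)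
          \<le> exp (- 2 * \<nu>m * (real n * \<sigma>)) * (K * (2 * R)\<^sup>2)"
        by (simp add: u_def)
    qed
  qed
qed

text \<open>
  The indices along the two subsequences are at least \<open>n\<close> at the \<open>n\<close>-th place, so the exponential
  bound applies there and the limit inherits its limit zero. No trajectories through the limit
  points have to be constructed.
\<close>

lemma form_of_limit_points_nonpos:
  assumes V: "\<And>v. \<bar>V v\<bar> \<le> K * (norm v)\<^sup>2" "K \<ge> 0" "continuous_on UNIV V"
    and R: "\<And>k. norm (\<psi> (real k * \<sigma>) q v) \<le> R"
    and mono: "strict_mono (r :: nat \<Rightarrow> nat)" "strict_mono (s :: nat \<Rightarrow> nat)"
    and lim: "(\<lambda>k. \<psi> (real (r k) * \<sigma>) q v) \<longlonglongrightarrow> x" "(\<lambda>k. \<psi> (real (s k) * \<sigma>) q v) \<longlonglongrightarrow> y"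
  shows "V (x - y) \<le> 0"
proof (rule tendsto_le[OF sequentially_bot])
  show "(\<lambda>n. V (\<psi> (real (r n) * \<sigma>) q v - \<psi> (real (s n) * \<sigma>) q v)) \<longlonglongrightarrow> V (x - y)"
    using lim V(3) by (intro continuous_on_tendsto_compose[of UNIV V] tendsto_diff) auto
  have "(\<lambda>n. exp (- 2 * \<nu>m * \<sigma>) ^ n) \<longlonglongrightarrow> 0"
    using exponent_pos period_pos by (intro LIMSEQ_realpow_zero) auto
  also have "(\<lambda>n. exp (- 2 * \<nu>m * \<sigma>) ^ n) = (\<lambda>n. exp (- 2 * \<nu>m * (real n * \<sigma>)))"
    by (simp flip: exp_of_nat_mult add: ac_simps)
  finally show "(\<lambda>n. exp (- 2 * \<nu>m * (real n * \<sigma>)) * (K * (2 * R)\<^sup>2)) \<longlonglongrightarrow> 0"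
    by (rule tendsto_mult_left_zero)
  show "\<forall>\<^sub>F n in sequentially. V (\<psi> (real (r n) * \<sigma>) q v - \<psi> (real (s n) * \<sigma>) q v)
      \<le> exp (- 2 * \<nu>m * (real n * \<sigma>)) * (K * (2 * R)\<^sup>2)"
    using form_of_iterates_decay[OF V(1,2) R]
    by eventually_elim (use mono in \<open>auto simp: seq_suble\<close>)
qed

text \<open>
  The iterates from the \<open>n\<close>-th on form the image of the whole orbit after \<open>n\<close> periods, and the
  finitely many earlier ones do not contribute to the measure of noncompactness. For large \<open>n\<close> this map
  at least halves the measure, which is finite, so it vanishes.
\<close>

lemma iterates_relatively_compact:
  assumes "asymptotically_compact \<psi> \<gamma>" and "\<gamma> \<ge> 0"
    and bounded: "bounded (range (\<lambda>k. \<psi> (real k * \<sigma>) q v))"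
  shows "compact (closure (range (\<lambda>k. \<psi> (real k * \<sigma>) q v)))"
proof (rule compact_closure_of_kuratowski_mnc_zero)
  define u where "u k = \<psi> (real k * \<sigma>) q v" for k
  let ?\<alpha> = "kuratowski_mnc (range u)"
  have u_add: "\<psi> (real n * \<sigma>) q (u k) = u (n + k)" for n k
    by (simp only: u_def iterate_add)
  obtain \<gamma>0 where \<gamma>0: "\<forall>t\<ge>0. 0 \<le> \<gamma>0 t" "(\<gamma>0 \<longlongrightarrow> 0) at_top"
    "\<forall>t\<ge>0. \<forall>B. bounded B \<longrightarrow> kuratowski_mnc {\<psi> t q' v | q' v. q' \<in> {q} \<and> v \<in> B}
       \<le> ennreal (\<gamma>0 t * exp (- \<gamma> * t)) * kuratowski_mnc B"
    using assms(1)[unfolded asymptotically_compact_def, rule_format, of "{q}"] by auto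
  have "(\<lambda>n. \<gamma>0 (real n * \<sigma>)) \<longlonglongrightarrow> 0"
    by (rule filterlim_compose[OF \<gamma>0(2) filterlim_periods])
  then have "\<forall>\<^sub>F n in sequentially. \<gamma>0 (real n * \<sigma>) < 1 / 2"
    by (rule order_tendstoD) simp
  then obtain n where n: "\<gamma>0 (real n * \<sigma>) < 1 / 2"
    by (auto simp: eventually_sequentially)
  have t: "real n * \<sigma> \<ge> 0"
    using period_pos by simp
  define S where "S = {\<psi> (real n * \<sigma>) q' v | q' v. q' \<in> {q} \<and> v \<in> range u}"
  have "u k \<in> u ` {..<n} \<union> S" for k
  proof (cases "k < n")
    case False
    then have "u k = \<psi> (real n * \<sigma>) q (u (k - n))"
      by (simp add: u_add)
    then show ?thesis
      unfolding S_def by blast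
  qed simp
  moreover have "S \<subseteq> range u"
    by (auto simp: S_def u_add)
  ultimately have "range u = u ` {..<n} \<union> S"
    by blast
  then have "?\<alpha> \<le> kuratowski_mnc S"
    using kuratowski_mnc_union_finite[of "u ` {..<n}" S] by simp
  also have "\<dots> \<le> ennreal (\<gamma>0 (real n * \<sigma>) * exp (- \<gamma> * (real n * \<sigma>))) * ?\<alpha>"
    unfolding S_def using \<gamma>0(3) t bounded by (simp add: u_def[abs_def])
  also have "\<dots> \<le> ennreal (1 / 2) * ?\<alpha>"
  proof (intro mult_right_mono ennreal_leI)
    have "\<gamma>0 (real n * \<sigma>) * exp (- \<gamma> * (real n * \<sigma>)) \<le> \<gamma>0 (real n * \<sigma>) * 1"
      using \<gamma>0(1) t assms(2) by (intro mult_left_mono) auto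
    then show "\<gamma>0 (real n * \<sigma>) * exp (- \<gamma> * (real n * \<sigma>)) \<le> 1 / 2"
      using n by simp
  qed simp
  finally have half: "?\<alpha> \<le> ennreal (1 / 2) * ?\<alpha>" .
  have "?\<alpha> < \<infinity>"
    using bounded by (intro kuratowski_mnc_bounded) (simp add: u_def[abs_def])
  then obtain a where a: "a \<ge> 0" "?\<alpha> = ennreal a"
    by (cases ?\<alpha>) auto
  then have "ennreal a \<le> ennreal (1 / 2 * a)"
    using half by (simp only: ennreal_mult' a(1))
  then have "a \<le> 1 / 2 * a"
    using a(1) by (simp only: ennreal_le_iff mult_nonneg_nonneg)
  then have "?\<alpha> = 0"
    using a by simp
  then show "kuratowski_mnc (range (\<lambda>k. \<psi> (real k * \<sigma>) q v)) = 0"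
    by (simp add: u_def[abs_def])
qed

text \<open>
  The values of \<open>f\<close> at the differences over one period are continuous in time. If they never vanish,
  they have constant sign by the intermediate value theorem, although the sequence only sees them at
  multiples of the period. If one of them vanishes, the trajectory is periodic from that time on.
\<close>

lemma functional_of_iterates_convergent:
  fixes f :: "'e \<Rightarrow> real"
  assumes "bounded_linear f" and sep: "\<And>v. V v \<le> 0 \<Longrightarrow> f v = 0 \<Longrightarrow> v = 0"
    and nonpos: "\<forall>\<^sub>F t in at_top. V (\<psi> (t + \<sigma>) q v - \<psi> t q v) \<le> 0"
    and bounded: "bounded (range (\<lambda>k. \<psi> (real k * \<sigma>) q v))"
  shows "convergent (\<lambda>k. f (\<psi> (real k * \<sigma>) q v))"
proof -
  interpret f: bounded_linear f by fact
  define a where "a k = f (\<psi> (real k * \<sigma>) q v)" for k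
  define g where "g t = f (\<psi> (t + \<sigma>) q v - \<psi> t q v)" for t
  have a_Suc: "a (Suc k) - a k = g (real k * \<sigma>)" for k
    by (simp add: a_def g_def f.diff algebra_simps)
  obtain t0 where t0: "\<And>t. t \<ge> t0 \<Longrightarrow> V (\<psi> (t + \<sigma>) q v - \<psi> t q v) \<le> 0"
    using nonpos by (auto simp: eventually_at_top_linorder)
  obtain N where "t0 < real N * \<sigma>"
    using reals_Archimedean3[OF period_pos] by blast
  then have N: "real k * \<sigma> \<ge> t0" if "k \<ge> N" for k
    using that period_pos by (smt (verit) mult_right_mono of_nat_le_iff)
  define T where "T = real N * \<sigma>"
  have T: "T \<ge> 0" "T \<ge> t0"
    using N[of N] period_pos by (auto simp: T_def)
  have T_le: "T \<le> real k * \<sigma>" if "k \<ge> N" for k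
    using that period_pos by (simp add: T_def)
  have "bounded (range a)"
    using bounded_linear_image[OF bounded assms(1)] by (simp add: a_def[abs_def] image_image)
  moreover have "\<exists>M. monoseq (\<lambda>k. a (k + M))"
  proof (cases "\<exists>t\<ge>T. g t = 0")
    case True
    then obtain t where t: "t \<ge> T" "g t = 0"
      by blast
    then have eq: "\<psi> t q (\<psi> \<sigma> q v) = \<psi> t q v"
      using sep[of "\<psi> (t + \<sigma>) q v - \<psi> t q v"] t0[of t] T cocycle_add_periods[of t 1 q v]
      by (simp add: g_def)
    obtain M where "t < real M * \<sigma>"
      using reals_Archimedean3[OF period_pos] by blast
    have "a (Suc k + M) = a (k + M)" for k
    proof -
      define r where "r = real (k + M) * \<sigma>"
      have "r \<ge> t"
        using \<open>t < real M * \<sigma>\<close> period_pos by (simp add: r_def distrib_right add_increasing)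
      have "\<psi> (r + \<sigma>) q v = \<psi> r q (\<psi> \<sigma> q v)"
        using cocycle_add_periods[of r 1 q v] \<open>r \<ge> t\<close> t(1) T(1) by simp
      also have "\<dots> = \<psi> r q v"
        by (rule cocycle_eq_persists[OF eq _ \<open>r \<ge> t\<close>]) (use t(1) T(1) in simp)
      finally show ?thesis
        by (simp add: a_def r_def algebra_simps)
    qed
    then have "monoseq (\<lambda>k. a (k + M))"
      by (simp add: monoseq_Suc)
    then show ?thesis
      by blast
  next
    case False
    have "continuous_on {T..} g"
      unfolding g_def using T(1) period_pos
      by (intro f.continuous_on continuous_intros continuous_on_compose2[OF continuous_on_trajectory]
          continuous_on_subset[OF continuous_on_trajectory]) auto
    then have "connected (g ` {T..})"
      by (intro connected_continuous_image) auto
    then have "is_interval (g ` {T..})"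
      by (simp add: is_interval_connected_1)
    moreover have "0 \<notin> g ` {T..}"
      using False by force
    ultimately consider "\<And>t. t \<ge> T \<Longrightarrow> g t > 0" | "\<And>t. t \<ge> T \<Longrightarrow> g t < 0"
      unfolding is_interval_1 by (smt (verit) atLeast_iff imageI)
    then show ?thesis
    proof cases
      case 1
      have "a (k + N) \<le> a (Suc k + N)" for k
        using 1[OF T_le, of "k + N"] a_Suc[of "k + N"] by simp
      then have "monoseq (\<lambda>k. a (k + N))"
        by (simp add: monoseq_Suc)
      then show ?thesis
        by blast
    next
      case 2
      have "a (Suc k + N) \<le> a (k + N)" for k
        using 2[OF T_le, of "k + N"] a_Suc[of "k + N"] by simp
      then have "monoseq (\<lambda>k. a (k + N))"
        by (simp add: monoseq_Suc)
      then show ?thesis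
        by blast
    qed
  qed
  then obtain M where "monoseq (\<lambda>k. a (k + M))"
    by blast
  ultimately have "convergent (\<lambda>k. a (k + M))"
    by (intro Bseq_monoseq_convergent) (auto simp: Bseq_eq_bounded bounded_iff)
  then have "convergent a"
    using convergent_ignore_initial_segment[of a M] by simp
  then show ?thesis
    by (simp add: a_def[abs_def])
qed

text \<open>
  Either the form of the difference over one period stays nonnegative, and the increments of the
  orbit are dominated by a geometric series; or it becomes negative, and a functional that is
  injective on pairs with nonpositive form of the difference converges along the orbit, which leaves
  room for a single limit point.
\<close>

lemma period_map_orbit_convergent:
  assumes B: "bounded_bilinear B" "\<And>v. V v = B v v"
    and sep: "\<And>v. V v \<le> 0 \<Longrightarrow> B v e = 0 \<Longrightarrow> v = 0"
    and compact: "asymptotically_compact \<psi> \<gamma>" "\<gamma> \<ge> 0"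
    and bounded: "bounded (range (\<lambda>k. \<psi> (real k * \<sigma>) q v))"
  shows "convergent (\<lambda>k. \<psi> (real k * \<sigma>) q v)"
proof -
  interpret B: bounded_bilinear B by fact
  define u where "u k = \<psi> (real k * \<sigma>) q v" for k
  have u_Suc: "u (Suc k) = \<psi> (real k * \<sigma>) q (\<psi> \<sigma> q v)" for k
    using iterate_add[of k q 1 v] by (simp add: u_def)
  have shift: "\<psi> (t + \<sigma>) q v = \<psi> t q (\<psi> \<sigma> q v)" if "t \<ge> 0" for t
    using cocycle_add_periods[of t 1 q v] that by simp
  show ?thesis
  proof (cases "\<forall>t\<ge>0. V (\<psi> t q (\<psi> \<sigma> q v) - \<psi> t q v) \<ge> 0")
    case True
    then obtain C where "\<forall>\<^sub>F t in at_top.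
        norm (\<psi> t q (\<psi> \<sigma> q v) - \<psi> t q v) \<le> C * exp (- \<nu>m * t)"
      using decay_of_form_nonneg by blast
    from eventually_compose_filterlim[OF this filterlim_periods]
    have "\<forall>\<^sub>F k in sequentially.
        norm (u (Suc k) - u k) \<le> C * exp (- \<nu>m * (real k * \<sigma>))"
      unfolding u_Suc unfolding u_def .
    then have "\<forall>\<^sub>F k in sequentially. norm (u (Suc k) - u k) \<le> C * exp (- \<nu>m * \<sigma>) ^ k"
      by (simp add: ac_simps flip: exp_of_nat_mult)
    moreover have "summable (\<lambda>k. C * exp (- \<nu>m * \<sigma>) ^ k)"
      using exponent_pos period_pos by (intro summable_mult summable_geometric) auto
    ultimately have "summable (\<lambda>k. u (Suc k) - u k)"
      by (rule summable_comparison_test_ev)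
    then have "(\<lambda>n. \<Sum>k<n. u (Suc k) - u k) \<longlonglongrightarrow> (\<Sum>k. u (Suc k) - u k)"
      by (rule summable_LIMSEQ)
    then have "(\<lambda>n. u n - u 0 + u 0) \<longlonglongrightarrow> (\<Sum>k. u (Suc k) - u k) + u 0"
      unfolding sum_lessThan_telescope by (intro tendsto_add tendsto_const)
    then have "convergent u"
      by (auto simp: convergent_def)
    then show ?thesis
      by (simp add: u_def[abs_def])
  next
    case False
    then obtain l where "l \<ge> 0" "V (\<psi> l q (\<psi> \<sigma> q v) - \<psi> l q v) \<le> 0"
      by force
    then have "\<forall>\<^sub>F t in at_top. V (\<psi> t q (\<psi> \<sigma> q v) - \<psi> t q v) \<le> 0"
      by (rule form_stays_nonpos)
    then have "\<forall>\<^sub>F t in at_top. V (\<psi> (t + \<sigma>) q v - \<psi> t q v) \<le> 0"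
      using eventually_ge_at_top[of 0] by eventually_elim (simp add: shift)
    then obtain c where c: "(\<lambda>k. B (u k) e) \<longlonglongrightarrow> c"
      using functional_of_iterates_convergent[OF B.bounded_linear_left sep _ bounded]
      by (auto simp: u_def convergent_def)
    obtain K where K: "K > 0" "\<And>v w. norm (B v w) \<le> norm v * norm w * K"
      using B.pos_bounded by blast
    have V_le: "\<bar>V v\<bar> \<le> K * (norm v)\<^sup>2" for v
      using K(2)[of v v] by (simp add: B(2) power2_eq_square ac_simps)
    have V_cont: "continuous_on UNIV V"
      unfolding B(2)[abs_def] by (intro B.continuous_on continuous_on_id)
    obtain R where R: "\<And>k. norm (\<psi> (real k * \<sigma>) q v) \<le> R"
      using bounded by (auto simp: bounded_iff)
    show ?thesis
    proof (rule compact_sequence_convergent[OF iterates_relatively_compact[OF compact bounded]])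
      show "\<psi> (real k * \<sigma>) q v \<in> closure (range (\<lambda>k. \<psi> (real k * \<sigma>) q v))" for k
        by (rule subsetD[OF closure_subset]) simp
      fix r s :: "nat \<Rightarrow> nat" and x y
      assume mono: "strict_mono r" "strict_mono s"
        and lim: "((\<lambda>k. \<psi> (real k * \<sigma>) q v) \<circ> r) \<longlonglongrightarrow> x" "((\<lambda>k. \<psi> (real k * \<sigma>) q v) \<circ> s) \<longlonglongrightarrow> y"
      then have "V (x - y) \<le> 0"
        by (intro form_of_limit_points_nonpos[OF V_le _ V_cont R]) (use K(1) in \<open>auto simp: comp_def\<close>)
      moreover have "B x e = c"
        using B.tendsto[OF lim(1) tendsto_const[of e]] LIMSEQ_subseq_LIMSEQ[OF c mono(1)]
        by (intro LIMSEQ_unique) (auto simp: comp_def u_def)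
      moreover have "B y e = c"
        using B.tendsto[OF lim(2) tendsto_const[of e]] LIMSEQ_subseq_LIMSEQ[OF c mono(2)]
        by (intro LIMSEQ_unique) (auto simp: comp_def u_def)
      ultimately show "x = y"
        using sep[of "x - y"] by (simp add: B.diff_left)
    qed
  qed
qed

end

section \<open>Convergence of bounded trajectories\<close>

theorem theorem5p2p1:
  fixes smulE :: "'k::real_or_complex \<Rightarrow> 'e::banach \<Rightarrow> 'e"
    and smulH :: "'k \<Rightarrow> 'h::banach \<Rightarrow> 'h"
    and ip :: "'h \<Rightarrow> 'h \<Rightarrow> 'k"
    and \<iota> :: "'e \<Rightarrow> 'h"
    and \<theta> :: "real \<Rightarrow> 'q::complete_space \<Rightarrow> 'q"
    and \<psi> :: "real \<Rightarrow> 'q \<Rightarrow> 'e \<Rightarrow> 'e"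
    and P :: "'e \<Rightarrow>\<^sub>L ('e \<Rightarrow>\<^sub>L 'k)"
    and Ep Em :: "'e set"
    and \<sigma> \<nu>m \<nu>p :: real
    and \<nu>0 :: "'q \<Rightarrow> real"
    and q :: 'q
    and v0 :: 'e
  assumes "banach_over smulE"
    and "hilbert_over smulH ip"
    and "continuous_embedding smulE smulH \<iota>"
    and "minimal_periodic_flow \<sigma> \<theta>"
    and "cocycle \<theta> \<psi>"
    and "operator_to_dual smulE P"
    and "symmetric_operator P"
    and "direct_sum_decomposition Ep Em"
    and "dim Em = 1"
    and "\<forall>v\<in>Ep - {0}. quadratic_form P v > 0"
    and "\<forall>v\<in>Em - {0}. quadratic_form P v < 0"
    and "squeezing \<theta> \<psi> \<iota> (quadratic_form P) \<nu>m \<nu>p \<nu>0"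
    and "continuous_on UNIV \<nu>0"
    and "\<nu>m > 0"
    and "asymptotically_compact \<psi> \<nu>p"
    and "uniform_lipschitz \<psi> \<iota>"
    and "bounded ((\<lambda>t. \<psi> t q v0) ` {0..})"
  shows "\<exists>w. complete_trajectory \<theta> \<psi> q w \<and> (\<forall>t. w (t + \<sigma>) = w t) \<and>
    ((\<lambda>t. norm (\<psi> t q v0 - w t)) \<longlongrightarrow> 0) at_top"
proof -
  have form: "quadratic_form P v = real_form P v v" for v
    by (rule quadratic_form_eq_real_form)
  obtain e where e: "\<And>v. real_form P v v \<le> 0 \<Longrightarrow> real_form P v e = 0 \<Longrightarrow> v = 0"
  proof (rule ex_separating_functional[OF bounded_bilinear_real_form])
    show "real_form P v w = real_form P w v" for v w
      by (rule real_form_commute) fact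
  qed (use assms(8-11) in \<open>auto simp: form\<close>)
  interpret squeezed_periodic_cocycle \<theta> \<psi> \<iota> "quadratic_form P" \<nu>m \<nu>p \<sigma> \<nu>0
    using assms by unfold_locales
      (auto simp: minimal_periodic_flow_def continuous_embedding_def)
  have "bounded (range (\<lambda>k. \<psi> (real k * \<sigma>) q v0))"
    by (rule bounded_subset[OF assms(17)]) (use period_pos in auto)
  moreover have "\<nu>p \<ge> 0"
    using assms(12,14) by (auto simp: squeezing_def)
  ultimately have "convergent (\<lambda>k. \<psi> (real k * \<sigma>) q v0)"
    using e assms(15)
    by (intro period_map_orbit_convergent[OF bounded_bilinear_real_form form]) (auto simp: form)
  then show ?thesis
    using convergence_of_convergent_period_map by (auto simp: convergent_def)
qed

end
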